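(* For each $C\in[0,1]$, define \[ R^{\star}(C) = \inf_{\beta>0}\Bigl[(1+\beta) - C\,(\beta+\beta^2)\,\ln\bigl(1+\tfrac{1}{\beta}\bigr)\Bigr]. \] Then $R^{\star}(C)$ is the optimal (largest) robustness guarantee achievable under $C$-consistency, i.e. for every $C\in[0,1]$: (Achievability) For every distribution $F$ on $[0,v_{\max}]$ and every $R\le R^{\star}(C)$, there exists a mechanism that is simultaneously $C$-consistent and $R$-robust for $F$. (Optimality) For every $R>R^{\star}(C)$, there exists a distribution $F$ on $[0,v_{\max}]$ such that no mechanism is simultaneously $C$-consistent and $R$-robust for $F$.
   Context: Fix $v_{\max}\in(0,\infty)$. A distribution $F$ on $[0,v_{\max}]$ is a (Borel) probability distribution, with the convention $F(v)=\mathbb P[V<v]$ for $V$ distributed according to $F$. Let $\mathrm{OPT}(F)=\max_{p\ge 0} p\,(1-F(p))$ be the optimal posted-price revenue. A buyer has a value $v\in[0,v_{\max}]$; the seller privately observes a signal $s$. In the accurate state $\mathsf A$ the value $v$ is arbitrary and $s=v$; in the hallucinatory state $\mathsf H$, $v\sim F$ and $s\sim F$ are independent. The buyer knows $v$ and the state but not $s$; the seller knows $s$ and $F$ only. A mechanism (for $F$) is an allocation rule $x(s,v,\theta)\in[0,1]$ and a payment rule $p(s,v,\theta)\in\mathbb R$, with $\theta\in\{\mathsf A,\mathsf H\}$ (measurable, and such that the expectations below are well defined), where $s$ is the seller's signal and $(v,\theta)$ the buyer's report, satisfying for all $v,v'\in[0,v_{\max}]$: - (IC) $\mathbb E_{s\sim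 F}[v\,x(s,v,\mathsf H)-p(s,v,\mathsf H)]\ge \mathbb E_{s\sim F}[v\,x(s,v',\mathsf H)-p(s,v',\mathsf H)]$ and $v\,x(v,v,\mathsf A)-p(v,v,\mathsf A)\ge v\,x(v,v',\mathsf H)-p(v,v',\mathsf H)$; - (IR) $\mathbb E_{s\sim F}[v\,x(s,v,\mathsf H)-p(s,v,\mathsf H)]\ge 0$ and $v\,x(v,v,\mathsf A)-p(v,v,\mathsf A)\ge 0$. (No further incentive constraints are imposed; deviations in which the buyer falsely reports state $\mathsf A$, or reports $\mathsf A$ with a wrong value, are not constrained.) The mechanism is $C$-consistent if $p(v,v,\mathsf A)\ge C\,v$ for all $v\in[0,v_{\max}]$. It is $R$-robust (for $F$) if $\mathbb E_{s\sim F,\,v\sim F}[p(s,v,\mathsf H)]\ge R\cdot \mathrm{OPT}(F)$, with $s,v$ independent. *)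

theory Defs
  imports "HOL-Probability.Probability"
begin

definition distribution_on :: "real \<Rightarrow> real measure \<Rightarrow> bool" where
  "distribution_on vmax F \<longleftrightarrow>
     prob_space F \<and> sets F = sets (restrict_space borel {0..vmax})"

(* The convention is P[V < v], not the right-continuous P[V \<le> v] of the library's cdf. *)
definition strict_cdf :: "real measure \<Rightarrow> real \<Rightarrow> real" where
  "strict_cdf F v = measure F {w \<in> space F. w < v}"

(* The supremum is a maximum: strict_cdf F is left-continuous, so the revenue is upper
   semicontinuous in r, and it vanishes for r > vmax. *)
definition OPT :: "real measure \<Rightarrow> real" where
  "OPT F = (SUP r\<in>{0..}. r * (1 - strict_cdf F r))"

datatype state = Accurate | Hallucinatory

(* Arguments of x and p: the seller's signal s, then the buyer's report (v, \<theta>).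
   As space F = {0..vmax}, values of x and p outside [0, vmax] are irrelevant.
   Expectations are well defined in the sense of integrability; since x is bounded and
   measurable, integrability of s \<mapsto> p s v Hallucinatory covers every interim utility. *)
definition mechanism ::
  "real \<Rightarrow> real measure \<Rightarrow> (real \<Rightarrow> real \<Rightarrow> state \<Rightarrow> real) \<Rightarrow> (real \<Rightarrow> real \<Rightarrow> state \<Rightarrow> real) \<Rightarrow> bool" where
  "mechanism vmax F x p \<longleftrightarrow>
     (\<forall>\<theta>. (\<lambda>(s, v). x s v \<theta>) \<in> borel_measurable (F \<Otimes>\<^sub>M F)) \<and>
     (\<forall>\<theta>. (\<lambda>(s, v). p s v \<theta>) \<in> borel_measurable (F \<Otimes>\<^sub>M F)) \<and>
     (\<forall>s\<in>{0..vmax}. \<forall>v\<in>{0..vmax}. \<forall>\<theta>. x s v \<theta> \<in> {0..1}) \<and>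
     (\<forall>v\<in>{0..vmax}. integrable F (\<lambda>s. p s v Hallucinatory)) \<and>
     integrable (F \<Otimes>\<^sub>M F) (\<lambda>(s, v). p s v Hallucinatory) \<and>
     \<comment> \<open>incentive compatibility\<close>
     (\<forall>v\<in>{0..vmax}. \<forall>v'\<in>{0..vmax}.
        (\<integral>s. v * x s v Hallucinatory - p s v Hallucinatory \<partial>F)
          \<ge> (\<integral>s. v * x s v' Hallucinatory - p s v' Hallucinatory \<partial>F)) \<and>
     (\<forall>v\<in>{0..vmax}. \<forall>v'\<in>{0..vmax}.
        v * x v v Accurate - p v v Accurate
          \<ge> v * x v v' Hallucinatory - p v v' Hallucinatory) \<and>
     \<comment> \<open>individual rationality\<close>
     (\<forall>v\<in>{0..vmax}. (\<integral>s. v * x s v Hallucinatory - p s v Hallucinatory \<partial>F) \<ge> 0) \<and>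
     (\<forall>v\<in>{0..vmax}. v * x v v Accurate - p v v Accurate \<ge> 0)"

definition consistent :: "real \<Rightarrow> real \<Rightarrow> (real \<Rightarrow> real \<Rightarrow> state \<Rightarrow> real) \<Rightarrow> bool" where
  "consistent vmax C p \<longleftrightarrow> (\<forall>v\<in>{0..vmax}. p v v Accurate \<ge> C * v)"

definition robust :: "real measure \<Rightarrow> real \<Rightarrow> (real \<Rightarrow> real \<Rightarrow> state \<Rightarrow> real) \<Rightarrow> bool" where
  "robust F R p \<longleftrightarrow>
     (\<integral>(s, v). p s v Hallucinatory \<partial>(F \<Otimes>\<^sub>M F)) \<ge> R * OPT F"

definition R_star :: "real \<Rightarrow> real" where
  "R_star C = (INF \<beta>\<in>{0<..}. (1 + \<beta>) - C * (\<beta> + \<beta>\<^sup>2) * ln (1 + 1 / \<beta>))"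

end

theory Submission
  imports Defs "HOL-Real_Asymp.Real_Asymp"
begin

text \<open>
  Write \<open>Q s = P (V \<ge> s)\<close> and let \<open>r\<close> be the optimal posted price. If \<open>r \<ge> C E s\<close>, posting \<open>r\<close> is
  consistent. Otherwise the seller randomises between the prices \<open>r\<close> and \<open>s\<close>, posting \<open>r\<close> with
  probability \<open>\<sigma> s = 1 - C c / (c + Q s)\<close>, where \<open>c\<close> is chosen by the intermediate value theorem such
  that the consistency constraint \<open>E [\<sigma> s (s - r)] \<le> (1 - C) E s\<close> is tight. The revenue is then
  \<open>(OPT + c r) E \<sigma>\<close>, and \<open>E \<sigma> \<ge> 1 - C c ln (1 + 1 / c)\<close> since \<open>Q s\<close> stochastically dominates the uniform
  distribution on \<open>[0, 1]\<close>; so \<open>c\<close> plays the role of \<open>\<beta>\<close>. If no such \<open>c\<close> exists, the limit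
  \<open>\<sigma> = 1 - C\<close> of \<open>c \<rightarrow> \<infinity>\<close> works.

  Conversely, let the revenue curve be a straight line of slope \<open>- \<beta>\<close>. The envelope theorem bounds
  the revenue of any mechanism by \<open>\<beta>\<close> times the utility of the highest type in state \<open>H\<close>, and
  consistency bounds this utility by \<open>vmax - C E s\<close>.
\<close>

subsection \<open>Survival function and revenue curve\<close>

definition survival :: "real measure \<Rightarrow> real \<Rightarrow> real" where
  "survival F a = 1 - strict_cdf F a"

locale value_distribution = prob_space F for F :: "real measure" +
  fixes vmax :: real
  assumes sets_F: "sets F = sets (restrict_space borel {0..vmax})"
begin

lemma space_F: "space F = {0..vmax}"
  using sets_eq_imp_space_eq[OF sets_F] by (simp add: space_restrict_space)

lemma measurable_value [measurable]: "(\<lambda>s. s) \<in> borel_measurable F"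
  using measurable_restrict_space1[of "\<lambda>s. s" borel borel "{0..vmax}"] sets_F
  by (simp cong: measurable_cong_sets)

lemma measurable_signal [measurable]: "fst \<in> borel_measurable (F \<Otimes>\<^sub>M F)"
  using measurable_compose[OF measurable_fst measurable_value, of F] by simp

lemma measurable_report [measurable]: "snd \<in> borel_measurable (F \<Otimes>\<^sub>M F)"
  using measurable_compose[OF measurable_snd measurable_value, of F] by simp

lemma integrable_bounded:
  fixes f :: "real \<Rightarrow> real"
  assumes "f \<in> borel_measurable F" and "\<And>s. 0 \<le> s \<Longrightarrow> s \<le> vmax \<Longrightarrow> \<bar>f s\<bar> \<le> B"
  shows "integrable F f"
  by (rule integrable_const_bound[where B = B])
    (use assms in \<open>auto intro!: AE_I2 simp: space_F\<close>)

lemma integrable_value [simp]: "integrable F (\<lambda>s. s)"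
  by (rule integrable_bounded[where B = vmax]) auto

lemma integrable_weighted:
  fixes w f :: "real \<Rightarrow> real"
  assumes "integrable F f" and [measurable]: "w \<in> borel_measurable F"
    and "\<And>s. 0 \<le> w s" and "\<And>s. w s \<le> 1"
  shows "integrable F (\<lambda>s. w s * f s)"
proof (rule Bochner_Integration.integrable_bound[OF assms(1)])
  show "(\<lambda>s. w s * f s) \<in> borel_measurable F"
    using assms(1) by measurable
  show "AE s in F. norm (w s * f s) \<le> norm (f s)"
    using assms(3,4) by (auto simp: abs_mult intro!: mult_left_le_one_le)
qed

lemma expectation_value_nonneg: "0 \<le> expectation (\<lambda>s. s)"
  by (rule Bochner_Integration.integral_nonneg) (simp add: space_F)

lemma expectation_value_le: "expectation (\<lambda>s. s) \<le> vmax"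
  by (rule integral_le_const) (auto simp: space_F intro!: AE_I2)

lemma vmax_nonneg: "0 \<le> vmax"
  using expectation_value_nonneg expectation_value_le by simp

lemma survival_eq: "survival F a = prob {w \<in> space F. a \<le> w}"
proof -
  have "{w \<in> space F. a \<le> w} = space F - {w \<in> space F. w < a}"
    by auto
  then show ?thesis
    by (simp add: survival_def strict_cdf_def prob_compl)
qed

lemma survival_nonneg: "0 \<le> survival F a"
  by (simp add: survival_eq)

lemma survival_le_1: "survival F a \<le> 1"
  by (simp add: survival_eq)

lemma survival_antimono: "a \<le> b \<Longrightarrow> survival F b \<le> survival F a"
  unfolding survival_eq by (rule finite_measure_mono) auto

lemma survival_beyond: "vmax < a \<Longrightarrow> survival F a = 0"
proof -
  assume "vmax < a"
  then have "{w \<in> space F. a \<le> w} = {}"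
    by (auto simp: space_F)
  then show "survival F a = 0"
    unfolding survival_eq by (simp only: measure_empty)
qed

lemma borel_measurable_survival: "survival F \<in> borel_measurable borel"
proof -
  have "mono (\<lambda>a. - survival F a)"
    by (auto intro!: monoI survival_antimono)
  from borel_measurable_uminus[OF borel_measurable_mono[OF this]] show ?thesis
    by simp
qed

lemma measurable_survival [measurable]: "survival F \<in> borel_measurable F"
  using measurable_compose[OF measurable_value borel_measurable_survival] .

text \<open>The convention P(V < a) makes the survival function count an atom at a. The events V >=
  a - 1 / (j + 1) decrease to V >= a, so it is continuous from the left.\<close>

lemma survival_left_limit: "(\<lambda>j. survival F (a - 1 / real (Suc j))) \<longlonglongrightarrow> survival F a"
proof -
  let ?A = "\<lambda>j. {w \<in> space F. a - 1 / real (Suc j) \<le> w}"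
  have "(\<lambda>j. prob (?A j)) \<longlonglongrightarrow> prob (\<Inter>j. ?A j)"
  proof (rule finite_Lim_measure_decseq)
    show "range ?A \<subseteq> events"
      by auto
    show "decseq ?A"
    proof (rule antimonoI, safe)
      fix i j :: nat and w
      assume "i \<le> j" and w: "a - 1 / real (Suc j) \<le> w"
      then have "1 / real (Suc j) \<le> 1 / real (Suc i)"
        by (intro divide_left_mono) auto
      with w show "a - 1 / real (Suc i) \<le> w"
        by linarith
    qed
  qed
  moreover have "(\<Inter>j. ?A j) = {w \<in> space F. a \<le> w}"
  proof (intro equalityI subsetI)
    fix w assume w: "w \<in> (\<Inter>j. ?A j)"
    have "(\<lambda>j. a - 1 / real (Suc j)) \<longlonglongrightarrow> a - 0"
      by (intro tendsto_diff tendsto_const LIMSEQ_Suc lim_1_over_n)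
    then have "a \<le> w"
      using w by (intro LIMSEQ_le_const2[of _ a]) auto
    with w show "w \<in> {w \<in> space F. a \<le> w}"
      by auto
  next
    fix w assume "w \<in> {w \<in> space F. a \<le> w}"
    then show "w \<in> (\<Inter>j. ?A j)"
      by (auto intro: order_trans[rotated])
  qed
  ultimately show ?thesis
    by (simp add: survival_eq)
qed

lemma revenue_le: "0 \<le> a \<Longrightarrow> a * survival F a \<le> vmax"
proof (cases "a \<le> vmax")
  case True
  assume "0 \<le> a"
  then have "a * survival F a \<le> a * 1"
    by (intro mult_left_mono survival_le_1)
  with True show ?thesis
    by simp
next
  case False
  then show ?thesis
    by (simp add: survival_beyond vmax_nonneg)
qed

lemma integrable_revenue [simp]: "integrable F (\<lambda>s. s * survival F s)"
  by (rule integrable_bounded[where B = vmax]) (auto simp: revenue_le survival_nonneg)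

lemma bdd_above_revenue: "bdd_above ((\<lambda>a. a * survival F a) ` {0..})"
  by (rule bdd_aboveI2[where M = vmax]) (use revenue_le in auto)

lemma OPT_eq: "OPT F = (SUP a\<in>{0..}. a * survival F a)"
  by (simp add: OPT_def survival_def)

lemma revenue_le_OPT: "0 \<le> a \<Longrightarrow> a * survival F a \<le> OPT F"
  unfolding OPT_eq by (rule cSUP_upper[OF _ bdd_above_revenue]) simp

lemma OPT_nonneg: "0 \<le> OPT F"
  using revenue_le_OPT[of 0] by simp

text \<open>A maximising sequence in [0, vmax] has a limit point r. Along a subsequence its terms
  eventually exceed r - 1 / (j + 1), which bounds their survival probabilities by the one at r - 1 /
  (j + 1); left continuity then lets j tend to infinity.\<close>

lemma OPT_attained:
  obtains r where "0 \<le> r" and "OPT F = r * survival F r"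
proof -
  have "\<exists>a\<in>{0..vmax}. OPT F - 1 / real (Suc n) < a * survival F a" for n
  proof -
    have "OPT F - 1 / real (Suc n) < (SUP a\<in>{0..}. a * survival F a)"
      by (simp add: OPT_eq)
    then obtain a where a: "0 \<le> a" "OPT F - 1 / real (Suc n) < a * survival F a"
      by (subst (asm) less_cSUP_iff) (auto intro: bdd_above_revenue)
    show ?thesis
    proof (cases "a \<le> vmax")
      case True
      with a show ?thesis
        by auto
    next
      case False
      \<comment> \<open>A price above vmax earns nothing, and so does the price 0.\<close>
      with a vmax_nonneg show ?thesis
        by (intro bexI[of _ 0]) (auto simp: survival_beyond)
    qed
  qed
  then obtain a where a: "\<And>n. a n \<in> {0..vmax}"
    and a_OPT: "\<And>n. OPT F - 1 / real (Suc n) < a n * survival F (a n)"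
    by metis
  obtain r k where r: "r \<in> {0..vmax}" and k: "strict_mono k" and lim: "(a \<circ> k) \<longlonglongrightarrow> r"
    using compact_imp_seq_compact[OF compact_Icc] a unfolding seq_compact_def by metis
  have "OPT F \<le> r * survival F (r - 1 / real (Suc j))" for j
  proof (rule LIMSEQ_le)
    have "(\<lambda>n. OPT F - 1 / real (Suc n)) \<longlonglongrightarrow> OPT F - 0"
      by (intro tendsto_diff tendsto_const LIMSEQ_Suc lim_1_over_n)
    from LIMSEQ_subseq_LIMSEQ[OF this k]
    show "(\<lambda>n. OPT F - 1 / real (Suc (k n))) \<longlonglongrightarrow> OPT F"
      by (simp add: o_def)
    show "(\<lambda>n. a (k n) * survival F (r - 1 / real (Suc j))) \<longlonglongrightarrow> r * survival F (r - 1 / real (Suc j))"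
      using lim by (auto intro!: tendsto_intros simp: o_def)
    have "\<forall>\<^sub>F n in sequentially. r - 1 / real (Suc j) < a (k n)"
      using order_tendstoD(1)[OF lim, of "r - 1 / real (Suc j)"] by (simp add: o_def)
    then have "\<forall>\<^sub>F n in sequentially. OPT F - 1 / real (Suc (k n))
        \<le> a (k n) * survival F (r - 1 / real (Suc j))"
    proof eventually_elim
      case (elim n)
      then have "a (k n) * survival F (a (k n)) \<le> a (k n) * survival F (r - 1 / real (Suc j))"
        using a[of "k n"] by (intro mult_left_mono survival_antimono) auto
      then show ?case
        using a_OPT[of "k n"] by linarith
    qed
    then show "\<exists>N. \<forall>n\<ge>N. OPT F - 1 / real (Suc (k n))
        \<le> a (k n) * survival F (r - 1 / real (Suc j))"
      by (simp add: eventually_sequentially)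
  qed
  then have "OPT F \<le> r * survival F r"
    by (intro LIMSEQ_le_const[OF tendsto_mult_left[OF survival_left_limit]]) auto
  with r revenue_le_OPT[of r] that[of r] show ?thesis
    by auto
qed

end

lemma distribution_on_iff_value_distribution:
  "distribution_on vmax F \<longleftrightarrow> value_distribution F vmax"
  by (auto simp: distribution_on_def value_distribution_def value_distribution_axioms_def)

subsection \<open>The survival function at a random value\<close>

text \<open>This is E(c / (c + U)) for uniform U, written with 1 - t because the survival
  probability at the t-quantile is at least 1 - t.\<close>

lemma integral_c_over_c_plus:
  fixes c :: real
  assumes "0 < c"
  shows "(\<integral>t. indicator {0..1} t * (c / (c + (1 - t))) \<partial>lborel) = c * ln (1 + 1 / c)"
proof -
  have "(\<integral>t. indicator {0..1} t *\<^sub>R (c / (c + (1 - t))) \<partial>lborel)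
      = (- c * ln (c + (1 - 1))) - (- c * ln (c + (1 - 0)))"
  proof (rule integral_FTC_atLeastAtMost)
    fix t :: real
    assume "0 \<le> t" "t \<le> 1"
    then show "((\<lambda>t. - c * ln (c + (1 - t))) has_vector_derivative c / (c + (1 - t))) (at t within {0..1})"
      unfolding has_real_derivative_iff_has_vector_derivative[symmetric]
      using assms by (auto intro!: derivative_eq_intros)
  qed (use assms in \<open>auto intro!: continuous_intros\<close>)
  also have "\<dots> = c * (ln (c + 1) - ln c)"
    by (simp add: algebra_simps)
  also have "ln (c + 1) - ln c = ln (1 + 1 / c)"
    using assms ln_div[of "c + 1" c] by (simp add: add_divide_distrib add.commute)
  finally show ?thesis
    by simp
qed

text \<open>
  The quantile function \<open>I\<close> turns the value into a uniform variable \<open>t\<close>, and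
  \<open>P(V \<ge> I t) \<ge> 1 - t\<close> even at atoms.
\<close>

lemma (in cdf_distribution) expectation_c_over_c_plus_survival:
  fixes c :: real
  assumes c: "0 < c"
  shows "expectation (\<lambda>x. c / (c + measure M {x..})) \<le> c * ln (1 + 1 / c)"
proof -
  let ?U = "restrict_space lborel {0<..<1} :: real measure"
  interpret U: prob_space ?U
    by (auto simp: emeasure_restrict_space space_restrict_space intro!: prob_spaceI)
  have I [measurable]: "I \<in> borel_measurable ?U"
    using measurable_CI by (simp cong: measurable_cong_sets add: sets_restrict_space)
  have "mono (\<lambda>x. - measure M {x..})"
    by (auto intro!: monoI finite_measure_mono)
  from borel_measurable_uminus[OF borel_measurable_mono[OF this]]
  have [measurable]: "(\<lambda>x. measure M {x..}) \<in> borel_measurable borel"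
    by simp
  have le: "c / (c + measure M {I t..}) \<le> c / (c + (1 - t))" if t: "0 < t" "t < 1" for t
  proof -
    have "C x \<le> t" if "x < I t" for x
      using pseudoinverse[OF t, of x] that by linarith
    then have "\<forall>\<^sub>F x in at_left (I t). C x \<le> t"
      by (auto simp: eventually_at_filter)
    \<comment> \<open>Approaching \<open>I t\<close> from the left leaves out its atom.\<close>
    then have "measure M {..<I t} \<le> t"
      by (intro tendsto_upperbound[OF cdf_at_left]) auto
    moreover have "measure M {I t..} = 1 - measure M {..<I t}"
      using prob_compl[of "{..<I t}"] by (simp add: Compl_eq_Diff_UNIV[symmetric] Compl_lessThan)
    ultimately show ?thesis
      using c t by (intro divide_left_mono) (auto intro!: mult_pos_pos add_pos_nonneg)
  qed
  have "expectation (\<lambda>x. c / (c + measure M {x..}))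
      = (\<integral>x. c / (c + measure M {x..}) \<partial>distr ?U borel I)"
    by (simp add: distr_I_eq_M)
  also have "\<dots> = (\<integral>t. c / (c + measure M {I t..}) \<partial>?U)"
    by (rule integral_distr) measurable
  also have "\<dots> \<le> (\<integral>t. c / (c + (1 - t)) \<partial>?U)"
  proof (rule integral_mono)
    have bound: "\<bar>c / (c + y)\<bar> \<le> 1" if "0 \<le> y" for y
      using c that by simp
    show "integrable ?U (\<lambda>t. c / (c + measure M {I t..}))"
      using bound[OF measure_nonneg]
      by (intro U.integrable_const_bound[where B = 1]) (auto intro!: AE_I2 simp del: abs_divide)
    have "(\<lambda>t. c / (c + (1 - t))) \<in> borel_measurable ?U"
      by (rule measurable_restrict_space1) auto
    then show "integrable ?U (\<lambda>t. c / (c + (1 - t)))"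
      by (intro U.integrable_const_bound[where B = 1])
        (auto simp: space_restrict_space simp del: abs_divide intro!: AE_I2 bound)
    show "c / (c + measure M {I t..}) \<le> c / (c + (1 - t))" if "t \<in> space ?U" for t
      using that le by (auto simp: space_restrict_space)
  qed
  also have "\<dots> = (\<integral>t. indicator {0<..<1} t *\<^sub>R (c / (c + (1 - t))) \<partial>lborel)"
    by (rule integral_restrict_space) auto
  \<comment> \<open>The quantile function lives on the open unit interval; the two end points form a
    null set.\<close>
  also have "\<dots> = (\<integral>t. indicator {0..1} t * (c / (c + (1 - t))) \<partial>lborel)"
  proof (rule integral_cong_AE)
    show "AE t in lborel. indicator {0<..<1} t *\<^sub>R (c / (c + (1 - t)))
        = indicator {0..1} t * (c / (c + (1 - t)))"
      using AE_lborel_singleton[of "0 :: real"] AE_lborel_singleton[of "1 :: real"]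
      by eventually_elim (auto simp: indicator_def)
  qed auto
  finally show ?thesis
    using integral_c_over_c_plus[OF c] by simp
qed

text \<open>Quantile functions belong to measures on the whole real line, so \<open>F\<close> is
  pushed forward along the identity.\<close>

lemma (in value_distribution) expectation_c_over_c_plus_survival:
  assumes "0 < c"
  shows "expectation (\<lambda>s. c / (c + survival F s)) \<le> c * ln (1 + 1 / c)"
proof -
  let ?M = "distr F borel (\<lambda>s. s)"
  interpret M: cdf_distribution ?M
    unfolding cdf_distribution_def by simp
  have M_survival: "measure ?M {x..} = survival F x" for x
    by (subst measure_distr) (auto simp: survival_eq intro!: arg_cong[where f = prob])
  note [measurable] = borel_measurable_survival
  have "expectation (\<lambda>s. c / (c + survival F s)) = M.expectation (\<lambda>x. c / (c + measure ?M {x..}))"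
    unfolding M_survival by (rule integral_distr[symmetric]) measurable
  with M.expectation_c_over_c_plus_survival[OF assms] show ?thesis
    by simp
qed

subsection \<open>Achievability\<close>

context value_distribution
begin

lemma expectation_sell:
  "(\<integral>v. (if a \<le> v then 1 else 0) \<partial>F) = survival F a"
proof -
  have "(\<integral>v. (if a \<le> v then 1 else 0) \<partial>F) = (\<integral>v. indicator {v \<in> space F. a \<le> v} v \<partial>F)"
    by (rule Bochner_Integration.integral_cong) auto
  also have "\<dots> = prob ({v \<in> space F. a \<le> v} \<inter> space F)"
    by (rule Bochner_Integration.integral_indicator)
  also have "{v \<in> space F. a \<le> v} \<inter> space F = {v \<in> space F. a \<le> v}"
    by auto
  finally show ?thesis
    by (simp add: survival_eq)
qed

text \<open>
  In state \<open>H\<close> the seller posts the price \<open>r\<close> with probability \<open>\<sigma> s\<close> and the signal \<open>s\<close> itself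
  otherwise. The payment deviates from the posted price by a term of mean zero in \<open>s\<close>, chosen so that
  \<open>s x - p \<le> (1 - C) s\<close> holds for every \<open>s\<close>; this is possible exactly because the expected excess
  of the signal over the price is at most \<open>(1 - C) E s\<close>.
\<close>

lemma posted_price_mixture:
  fixes \<sigma> :: "real \<Rightarrow> real"
  assumes \<sigma> [measurable]: "\<sigma> \<in> borel_measurable F"
    and \<sigma>_bounds: "\<And>s. 0 \<le> \<sigma> s" "\<And>s. \<sigma> s \<le> 1"
    and C: "0 \<le> C" "C \<le> 1"
    and excess: "expectation (\<lambda>s. \<sigma> s * (s - r)) \<le> (1 - C) * expectation (\<lambda>s. s)"
  shows "\<exists>x p. mechanism vmax F x p \<and> consistent vmax C p \<and>
    (\<integral>(s, v). p s v Hallucinatory \<partial>(F \<Otimes>\<^sub>M F))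
      = expectation (\<lambda>s. \<sigma> s * (r * survival F r) + (1 - \<sigma> s) * (s * survival F s))"
proof -
  define \<mu> where "\<mu> = expectation (\<lambda>s. s)"
  define \<kappa> where "\<kappa> = expectation (\<lambda>s. \<sigma> s * (s - r))"
  define b :: "real \<Rightarrow> real \<Rightarrow> real" where "b a v = (if a \<le> v then 1 else 0)" for a v
  define y where "y s v = \<sigma> s * b r v + (1 - \<sigma> s) * b s v" for s v
  \<comment> \<open>By this choice \<open>s * y s v - q s v\<close> is (1 - C) s minus the slack
    \<open>(1 - C) * \<mu> - \<kappa> * b r v\<close>. Subtracting \<open>\<kappa> * b r v\<close>
    brings the mean over s back to the mean posted-price payment.\<close>
  define q where "q s v = s * y s v - (1 - C) * s + (1 - C) * \<mu> - \<kappa> * b r v" for s v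
  define x where "x s v \<theta> = (case \<theta> of Accurate \<Rightarrow> 1 | Hallucinatory \<Rightarrow> y s v)" for s v :: real and \<theta>
  \<comment> \<open>In state A the buyer always gets the good at the price C v, so consistency is
    tight and the truthful utility is (1 - C) v.\<close>
  define p where "p s v \<theta> = (case \<theta> of Accurate \<Rightarrow> C * v | Hallucinatory \<Rightarrow> q s v)" for s v :: real and \<theta>
  have \<mu>: "0 \<le> \<mu>"
    unfolding \<mu>_def by (rule expectation_value_nonneg)
  have b: "0 \<le> b a v" "b a v \<le> 1" for a v
    by (auto simp: b_def)
  have y: "0 \<le> y s v" "y s v \<le> 1" for s v
  proof -
    show "0 \<le> y s v"
      unfolding y_def using \<sigma>_bounds[of s] b by simp
    have "\<sigma> s * b r v + (1 - \<sigma> s) * b s v \<le> \<sigma> s * 1 + (1 - \<sigma> s) * 1"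
      using \<sigma>_bounds[of s] b by (intro add_mono mult_left_mono) auto
    then show "y s v \<le> 1"
      by (simp add: y_def)
  qed
  have [measurable]: "(\<lambda>z. \<sigma> (fst z)) \<in> borel_measurable (F \<Otimes>\<^sub>M F)"
    by (rule measurable_compose[OF measurable_fst \<sigma>])
  have y_meas [measurable]: "(\<lambda>z. y (fst z) (snd z)) \<in> borel_measurable (F \<Otimes>\<^sub>M F)"
    unfolding y_def b_def by measurable
  have q_meas [measurable]: "(\<lambda>z. q (fst z) (snd z)) \<in> borel_measurable (F \<Otimes>\<^sub>M F)"
    unfolding q_def y_def b_def by measurable
  have y_meas' [measurable]: "(\<lambda>s. y s v) \<in> borel_measurable F" for v
    unfolding y_def b_def by measurable
  have q_meas' [measurable]: "(\<lambda>s. q s v) \<in> borel_measurable F" for v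
    unfolding q_def y_def b_def by measurable
  have q_bound: "\<bar>q s v\<bar> \<le> vmax + vmax + \<mu> + \<bar>\<kappa>\<bar>" if "0 \<le> s" "s \<le> vmax" for s v
  proof -
    have "0 \<le> s * y s v" "s * y s v \<le> s * 1" "0 \<le> (1 - C) * s" "(1 - C) * s \<le> 1 * s"
      "0 \<le> (1 - C) * \<mu>" "(1 - C) * \<mu> \<le> 1 * \<mu>" "\<bar>\<kappa> * b r v\<bar> \<le> \<bar>\<kappa>\<bar>"
      using that y[of s v] b[of r v] C \<mu>
      by (auto simp: abs_mult intro!: mult_left_mono mult_right_mono mult_nonneg_nonneg mult_left_le mult_left_le_one_le)
    with that show ?thesis
      unfolding q_def by linarith
  qed
  have q_int [simp]: "integrable F (\<lambda>s. q s v)" for v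
    using q_bound by (intro integrable_bounded) auto
  interpret P: pair_prob_space F F ..
  have q_int2: "integrable (F \<Otimes>\<^sub>M F) (\<lambda>z. q (fst z) (snd z))"
    by (rule P.integrable_const_bound[where B = "vmax + vmax + \<mu> + \<bar>\<kappa>\<bar>"])
      (use q_bound in \<open>auto intro!: AE_I2 simp: space_pair_measure space_F\<close>)

  \<comment> \<open>The utility of type v reporting w if the posted price itself were paid. Truthful
    reporting is optimal for every s, and the mean-zero correction carries this over to the interim
    constraints.\<close>
  define u where "u v w s = \<sigma> s * ((v - r) * b r w) + (1 - \<sigma> s) * ((v - s) * b s w)" for v w s
  have u_meas [measurable]: "u v w \<in> borel_measurable F" for v w
    unfolding u_def b_def by measurable
  have u_int: "integrable F (u v w)" for v w
  proof -
    have int: "integrable F (\<lambda>s. (v - s) * b s w)"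
    proof (rule integrable_bounded[where B = "\<bar>v\<bar> + vmax"])
      show "\<bar>(v - s) * b s w\<bar> \<le> \<bar>v\<bar> + vmax" if "0 \<le> s" "s \<le> vmax" for s
        using that by (auto simp: b_def)
    qed (simp add: b_def)
    have "integrable F (\<lambda>s. \<sigma> s * ((v - r) * b r w))"
      by (rule integrable_weighted) (use \<sigma>_bounds in auto)
    moreover have "integrable F (\<lambda>s. (1 - \<sigma> s) * ((v - s) * b s w))"
      by (rule integrable_weighted[OF int]) (use \<sigma>_bounds in auto)
    ultimately show ?thesis
      by (simp add: u_def[abs_def])
  qed
  have utility: "(\<integral>s. v * y s w - q s w \<partial>F) = (\<integral>s. u v w s \<partial>F)" for v w
  proof -
    have "integrable F (\<lambda>s. \<sigma> s * (s - r))"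
      by (rule integrable_weighted) (use \<sigma>_bounds in auto)
    then have "(\<integral>s. u v w s + b r w * (\<kappa> - \<sigma> s * (s - r)) + (1 - C) * (s - \<mu>) \<partial>F) = (\<integral>s. u v w s \<partial>F)"
      using u_int by (simp add: \<kappa>_def \<mu>_def prob_space)
    moreover have "v * y s w - q s w = u v w s + b r w * (\<kappa> - \<sigma> s * (s - r)) + (1 - C) * (s - \<mu>)" for s
      by (simp add: u_def y_def q_def algebra_simps)
    ultimately show ?thesis
      by simp
  qed
  have u_nonneg: "0 \<le> u v v s" for v s
    unfolding u_def using \<sigma>_bounds[of s] by (auto simp: b_def)
  have u_mono: "u v w s \<le> u v v s" for v w s
  proof -
    have "(v - t) * b t w \<le> (v - t) * b t v" for t
      by (auto simp: b_def)
    then show ?thesis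
      unfolding u_def using \<sigma>_bounds[of s] by (intro add_mono mult_left_mono[of "_ * _"]) auto
  qed

  have "mechanism vmax F x p"
    unfolding mechanism_def
  proof (intro conjI allI ballI)
    fix \<theta>
    show "(\<lambda>(s, v). x s v \<theta>) \<in> borel_measurable (F \<Otimes>\<^sub>M F)"
      using y_meas by (cases \<theta>) (simp_all add: x_def split_beta')
    show "(\<lambda>(s, v). p s v \<theta>) \<in> borel_measurable (F \<Otimes>\<^sub>M F)"
      using q_meas by (cases \<theta>) (simp_all add: p_def split_beta')
    show "x s v \<theta> \<in> {0..1}" for s v
      using y by (cases \<theta>) (simp_all add: x_def)
  next
    show "integrable F (\<lambda>s. p s v Hallucinatory)" for v
      by (simp add: p_def)
    show "integrable (F \<Otimes>\<^sub>M F) (\<lambda>(s, v). p s v Hallucinatory)"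
      using q_int2 by (simp add: p_def split_beta')
    show "(\<integral>s. v * x s v Hallucinatory - p s v Hallucinatory \<partial>F)
        \<ge> (\<integral>s. v * x s w Hallucinatory - p s w Hallucinatory \<partial>F)" for v w
      unfolding x_def p_def using u_mono u_int by (simp add: utility integral_mono)
    show "(\<integral>s. v * x s v Hallucinatory - p s v Hallucinatory \<partial>F) \<ge> 0" for v
      unfolding x_def p_def using u_nonneg by (simp add: utility Bochner_Integration.integral_nonneg)
    show "v * x v v Accurate - p v v Accurate \<ge> 0" if "v \<in> {0..vmax}" for v
      using that C by (auto simp: x_def p_def mult_left_le_one_le)
    show "v * x v v Accurate - p v v Accurate \<ge> v * x v w Hallucinatory - p v w Hallucinatory" for v w
    proof -
      \<comment> \<open>Reporting H in state A yields (1 - C) v plus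
        \<open>\<kappa> * b r w - (1 - C) * \<mu>\<close>. As \<open>b r w\<close> is 0 or 1, this
        is nonpositive by \<mu> >= 0 or by \<open>excess\<close>.\<close>
      have "\<kappa> * b r w \<le> (1 - C) * \<mu>"
        using excess \<mu> C by (auto simp: b_def \<kappa>_def \<mu>_def)
      then show ?thesis
        by (simp add: x_def p_def q_def algebra_simps)
    qed
  qed
  moreover have "consistent vmax C p"
    by (simp add: consistent_def p_def)
  moreover have "(\<integral>(s, v). p s v Hallucinatory \<partial>(F \<Otimes>\<^sub>M F))
      = expectation (\<lambda>s. \<sigma> s * (r * survival F r) + (1 - \<sigma> s) * (s * survival F s))"
  proof -
    have "(\<integral>(s, v). p s v Hallucinatory \<partial>(F \<Otimes>\<^sub>M F)) = (\<integral>z. q (fst z) (snd z) \<partial>(F \<Otimes>\<^sub>M F))"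
      by (simp add: p_def split_beta')
    also have "\<dots> = (\<integral>s. (\<integral>v. q s v \<partial>F) \<partial>F)"
      using P.integral_fst'[OF q_int2] by simp
    \<comment> \<open>Integrating over v first turns sale indicators into survival probabilities;
      the second summand has mean zero in s.\<close>
    also have "\<dots> = (\<integral>s. (\<sigma> s * (r * survival F r) + (1 - \<sigma> s) * (s * survival F s))
        + (survival F r * (\<sigma> s * (s - r) - \<kappa>) - (1 - C) * (s - \<mu>)) \<partial>F)"
    proof (rule Bochner_Integration.integral_cong[OF refl])
      fix s
      have [simp]: "integrable F (b a)" for a
        unfolding b_def by (rule integrable_bounded[where B = 1]) auto
      have [simp]: "expectation (b a) = survival F a" for a
        unfolding b_def by (rule expectation_sell)
      show "(\<integral>v. q s v \<partial>F) = (\<sigma> s * (r * survival F r) + (1 - \<sigma> s) * (s * survival F s))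
        + (survival F r * (\<sigma> s * (s - r) - \<kappa>) - (1 - C) * (s - \<mu>))"
        unfolding q_def y_def by (simp add: prob_space algebra_simps)
    qed
    also have "\<dots> = expectation (\<lambda>s. \<sigma> s * (r * survival F r) + (1 - \<sigma> s) * (s * survival F s))"
    proof -
      have "integrable F (\<lambda>s. \<sigma> s * (s - r))"
        by (rule integrable_weighted) (use \<sigma>_bounds in auto)
      moreover have "integrable F (\<lambda>s. \<sigma> s * (r * survival F r) + (1 - \<sigma> s) * (s * survival F s))"
      proof (rule Bochner_Integration.integrable_add)
        show "integrable F (\<lambda>s. (1 - \<sigma> s) * (s * survival F s))"
          by (rule integrable_weighted[OF integrable_revenue]) (use \<sigma>_bounds in auto)
      qed (use \<sigma>_bounds in \<open>auto intro: integrable_bounded[where B = 1]\<close>)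
      ultimately show ?thesis
        by (simp add: \<kappa>_def \<mu>_def prob_space)
    qed
    finally show ?thesis .
  qed
  ultimately show ?thesis
    by blast
qed

end

section \<open>Bounds on \<open>R_star\<close>\<close>

lemma robustness_bound_nonneg:
  fixes C \<beta> :: real
  assumes "0 \<le> C" "C \<le> 1" "0 < \<beta>"
  shows "0 \<le> (1 + \<beta>) - C * (\<beta> + \<beta>\<^sup>2) * ln (1 + 1 / \<beta>)"
proof -
  have "C * (\<beta> + \<beta>\<^sup>2) * ln (1 + 1 / \<beta>) \<le> 1 * (\<beta> + \<beta>\<^sup>2) * (1 / \<beta>)"
    using assms by (intro mult_mono ln_add_one_self_le_self) auto
  also have "\<dots> = 1 + \<beta>"
    using assms by (simp add: field_simps power2_eq_square)
  finally show ?thesis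
    by simp
qed

lemma bdd_below_robustness_bound:
  fixes C :: real
  assumes "0 \<le> C" "C \<le> 1"
  shows "bdd_below ((\<lambda>\<beta>. (1 + \<beta>) - C * (\<beta> + \<beta>\<^sup>2) * ln (1 + 1 / \<beta>)) ` {0<..})"
  by (rule bdd_belowI2[where m = 0], rule robustness_bound_nonneg) (use assms in auto)

text \<open>Serves the optimality half, where any R above \<open>R_star C\<close> must be
  nonnegative to multiply a lower bound on \<open>OPT F\<close>.\<close>

lemma R_star_nonneg: "0 \<le> C \<Longrightarrow> C \<le> 1 \<Longrightarrow> 0 \<le> R_star C"
  unfolding R_star_def by (rule cINF_greatest, simp, rule robustness_bound_nonneg) auto

text \<open>The factored form fits the achievability proof: with \<beta> = c, the second factor is
  the lower bound on the mean of the weight \<sigma>.\<close>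

lemma R_star_le:
  assumes "0 \<le> C" "C \<le> 1" "0 < \<beta>"
  shows "R_star C \<le> (1 + \<beta>) * (1 - C * (\<beta> * ln (1 + 1 / \<beta>)))"
proof -
  have "R_star C \<le> (1 + \<beta>) - C * (\<beta> + \<beta>\<^sup>2) * ln (1 + 1 / \<beta>)"
    unfolding R_star_def
    by (rule cINF_lower[OF bdd_below_robustness_bound]) (use assms in auto)
  then show ?thesis
    by (simp add: algebra_simps power2_eq_square)
qed

text \<open>As \<beta> tends to 0, the first factor in \<open>R_star_le\<close> tends to 1, while
  the second is at most 1.\<close>

lemma R_star_le_1:
  assumes "0 \<le> C" "C \<le> 1"
  shows "R_star C \<le> 1"
proof (rule field_le_epsilon)
  fix e :: real
  assume e: "0 < e"
  have "(1 + e) * (1 - C * (e * ln (1 + 1 / e))) \<le> (1 + e) * 1"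
    using assms e by (intro mult_left_mono) auto
  with R_star_le[OF assms e] show "R_star C \<le> 1 + e"
    by simp
qed

section \<open>Choice of the randomisation weights\<close>

context value_distribution
begin

text \<open>
  The identity \<open>(1 - \<sigma>) Q = c (\<sigma> - (1 - C))\<close> turns the revenue into \<open>(OPT + c r) E \<sigma>\<close> when the
  consistency constraint is tight. For \<open>C = 1\<close> the weights \<open>\<sigma> = Q / (c + Q)\<close> and \<open>1 - \<sigma>\<close> are those that
  combine \<open>A - c s\<close> and \<open>s Q\<close> to \<open>A Q / (c + Q)\<close>, the value at which they cross as functions of \<open>s\<close>.
\<close>

lemma optimal_mechanism_exists:
  assumes C: "0 \<le> C" "C \<le> 1"
  shows "\<exists>x p. mechanism vmax F x p \<and> consistent vmax C p \<and>
    R_star C * OPT F \<le> (\<integral>(s, v). p s v Hallucinatory \<partial>(F \<Otimes>\<^sub>M F))"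
proof -
  define \<mu> where "\<mu> = expectation (\<lambda>s. s)"
  obtain r where r: "0 \<le> r" and OPT_r: "OPT F = r * survival F r"
    by (rule OPT_attained)
  have OPT_le_r: "OPT F \<le> r"
    using r survival_le_1[of r] by (simp add: OPT_r mult_left_le)
  define d where "d c s = c / (c + survival F s)" for c s
  define \<sigma> where "\<sigma> c s = 1 - C * d c s" for c s
  define g where "g c = expectation (\<lambda>s. \<sigma> c s * (s - r))" for c
  have d_meas [measurable]: "d c \<in> borel_measurable F" for c
    unfolding d_def by measurable
  have \<sigma>_meas [measurable]: "\<sigma> c \<in> borel_measurable F" for c
    unfolding \<sigma>_def by measurable
  have d_bounds: "0 \<le> d c s" "d c s \<le> 1" if "0 < c" for c s
    using that survival_nonneg[of s] by (auto simp: d_def)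
  have \<sigma>_bounds: "0 \<le> \<sigma> c s" "\<sigma> c s \<le> 1" if "0 < c" for c s
    using d_bounds[OF that, of s] C by (auto simp: \<sigma>_def intro!: mult_le_one)
  have d_int [simp]: "integrable F (d c)" if "0 < c" for c
    using d_bounds[OF that] by (intro integrable_bounded[where B = 1]) auto
  have \<sigma>_int [simp]: "integrable F (\<sigma> c)" if "0 < c" for c
    using that by (simp add: \<sigma>_def[abs_def])
  have weighted_int: "integrable F (\<lambda>s. \<sigma> c s * f s)" if "0 < c" "integrable F f" for c f
    using \<sigma>_bounds that by (intro integrable_weighted) auto
  have E\<sigma>: "1 - C * (c * ln (1 + 1 / c)) \<le> expectation (\<sigma> c)" if "0 < c" for c
  proof -
    have "expectation (d c) \<le> c * ln (1 + 1 / c)"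
      unfolding d_def using expectation_c_over_c_plus_survival[OF that] .
    with that C show ?thesis
      by (simp add: \<sigma>_def[abs_def] prob_space mult_left_mono)
  qed
  have E\<sigma>_nonneg: "0 \<le> expectation (\<sigma> c)" if "0 < c" for c
    using \<sigma>_bounds(1)[OF that] by (rule Bochner_Integration.integral_nonneg)
  \<comment> \<open>The target for the revenue: the interior case meets it directly, the limit case
    up to a factor tending to 1.\<close>
  have R_star_OPT: "R_star C * OPT F \<le> (1 + c) * OPT F * expectation (\<sigma> c)" if "0 < c" for c
  proof -
    have "R_star C * OPT F \<le> (1 + c) * (1 - C * (c * ln (1 + 1 / c))) * OPT F"
      using R_star_le[OF C that] OPT_nonneg by (rule mult_right_mono)
    also have "\<dots> \<le> (1 + c) * expectation (\<sigma> c) * OPT F"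
      using E\<sigma>[OF that] OPT_nonneg that by (intro mult_left_mono mult_right_mono) auto
    finally show ?thesis
      by (simp add: ac_simps)
  qed
  have weighted_value: "expectation (\<lambda>s. \<sigma> c s * s) = g c + r * expectation (\<sigma> c)" if "0 < c" for c
    unfolding g_def right_diff_distrib using that weighted_int[OF that] by simp

  \<comment> \<open>For r < C \<mu> the excess \<open>g c\<close> is at least (1 - C) \<mu> for
    small c, so it either attains this level or stays above it for every c.\<close>
  consider (fixed_price) "C * \<mu> \<le> r"
    | (interior) c where "0 < c" "g c = (1 - C) * \<mu>"
    | (limit) "\<And>c. 0 < c \<Longrightarrow> (1 - C) * \<mu> < g c"
  proof (cases "r < C * \<mu> \<and> (\<exists>c>0. g c \<le> (1 - C) * \<mu>)")
    case True
    then obtain c1 where c1: "0 < c1" "g c1 \<le> (1 - C) * \<mu>" and less: "r < C * \<mu>"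
      by auto
    define K where "K = vmax + r"
    have K: "\<bar>s - r\<bar> \<le> K" if "0 \<le> s" "s \<le> vmax" for s
      using that r by (simp add: K_def)
    have K_nonneg: "0 \<le> K"
      using r vmax_nonneg by (simp add: K_def)
    \<comment> \<open>As c tends to 0 the mean of \<open>d c\<close> vanishes, and this lower bound
      tends to \<mu> - r, which exceeds (1 - C) \<mu> exactly when r < C \<mu>.\<close>
    have lower: "\<mu> - r - C * (c * ln (1 + 1 / c)) * K \<le> g c" if "0 < c" for c
    proof -
      have "\<mu> - r - C * (c * ln (1 + 1 / c)) * K \<le> \<mu> - r - C * expectation (d c) * K"
        using expectation_c_over_c_plus_survival[OF that] C K_nonneg
        by (intro diff_left_mono mult_right_mono mult_left_mono) (auto simp: d_def[abs_def])
      also have "\<dots> = expectation (\<lambda>s. s - r - C * d c s * K)"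
        using that by (simp add: \<mu>_def prob_space)
      also have "\<dots> \<le> g c"
        unfolding g_def
      proof (rule integral_mono)
        fix s assume "s \<in> space F"
        then have "C * d c s * (s - r) \<le> C * d c s * K"
          using K[of s] C d_bounds[OF that, of s] by (intro mult_left_mono) (auto simp: space_F)
        then show "s - r - C * d c s * K \<le> \<sigma> c s * (s - r)"
          by (simp add: \<sigma>_def algebra_simps)
      qed (use that weighted_int in auto)
      finally show ?thesis .
    qed
    have "((\<lambda>c. \<mu> - r - C * (c * ln (1 + 1 / c)) * K) \<longlongrightarrow> \<mu> - r - C * 0 * K) (at_right 0)"
    proof (intro tendsto_intros)
      show "((\<lambda>c::real. c * ln (1 + 1 / c)) \<longlongrightarrow> 0) (at_right 0)"
        by real_asymp
    qed
    moreover have "(1 - C) * \<mu> < \<mu> - r - C * 0 * K"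
      using less by (simp add: algebra_simps)
    ultimately have "\<forall>\<^sub>F c in at_right 0. (1 - C) * \<mu> < \<mu> - r - C * (c * ln (1 + 1 / c)) * K"
      by (rule order_tendstoD(1))
    moreover have "\<forall>\<^sub>F c in at_right 0. 0 < c \<and> c < c1"
      using eventually_at_right_real[OF c1(1)] by eventually_elim auto
    ultimately have "\<forall>\<^sub>F c in at_right 0. 0 < c \<and> c < c1 \<and> (1 - C) * \<mu> \<le> g c"
      by eventually_elim (use lower in force)
    then obtain c0 where c0: "0 < c0" "c0 < c1" "(1 - C) * \<mu> \<le> g c0"
      using eventually_happens'[OF trivial_limit_at_right_real] by blast
    \<comment> \<open>Dominated convergence: c0 > 0 keeps the denominators
      \<open>c + survival F s\<close> away from 0.\<close>
    have "continuous_on {c0..c1} g"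
      unfolding continuous_on_sequentially
    proof (intro allI ballI impI)
      fix X c
      assume X: "c \<in> {c0..c1}" "(\<forall>n. X n \<in> {c0..c1}) \<and> X \<longlonglongrightarrow> c"
      then have pos: "0 < c" "0 < X n" for n
        using c0(1) by (auto intro: less_le_trans)
      have "(\<lambda>n. expectation (\<lambda>s. \<sigma> (X n) s * (s - r))) \<longlonglongrightarrow> expectation (\<lambda>s. \<sigma> c s * (s - r))"
      proof (rule integral_dominated_convergence[where w = "\<lambda>_. K"])
        show "AE s in F. (\<lambda>n. \<sigma> (X n) s * (s - r)) \<longlonglongrightarrow> \<sigma> c s * (s - r)"
          using X pos(1) survival_nonneg unfolding \<sigma>_def d_def
          by (intro AE_I2 tendsto_intros) (auto simp: add_pos_nonneg less_imp_neq[symmetric])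
        show "AE s in F. norm (\<sigma> (X n) s * (s - r)) \<le> K" for n
        proof (rule AE_I2)
          fix s assume "s \<in> space F"
          then have "\<bar>\<sigma> (X n) s\<bar> * \<bar>s - r\<bar> \<le> 1 * K"
            using K[of s] \<sigma>_bounds[OF pos(2)[of n], of s] by (intro mult_mono) (auto simp: space_F)
          then show "norm (\<sigma> (X n) s * (s - r)) \<le> K"
            by (simp add: abs_mult)
        qed
      qed auto
      then show "(g \<circ> X) \<longlonglongrightarrow> g c"
        by (simp add: g_def[abs_def] o_def)
    qed
    then obtain c where "c0 \<le> c" "g c = (1 - C) * \<mu>"
      using IVT2'[of g c1 "(1 - C) * \<mu>" c0] c0 c1 by auto
    with c0 show ?thesis
      by (intro interior[of c]) auto
  next
    case False
    then show ?thesis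
      using fixed_price limit by (meson not_le)
  qed
  then show ?thesis
  proof cases
    case fixed_price
    \<comment> \<open>The constant weight \<sigma> = 1 has excess \<mu> - r and revenue
      \<open>OPT F\<close>.\<close>
    have "expectation (\<lambda>s. 1 * (s - r)) \<le> (1 - C) * expectation (\<lambda>s. s)"
      using fixed_price by (simp add: \<mu>_def prob_space algebra_simps)
    then obtain x p where "mechanism vmax F x p" "consistent vmax C p"
      and "(\<integral>(s, v). p s v Hallucinatory \<partial>(F \<Otimes>\<^sub>M F))
        = expectation (\<lambda>s. 1 * (r * survival F r) + (1 - 1) * (s * survival F s))"
      using posted_price_mixture[of "\<lambda>_. 1" C r] C by auto
    moreover have "R_star C * OPT F \<le> 1 * OPT F"
      using R_star_le_1[OF C] OPT_nonneg by (rule mult_right_mono)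
    ultimately show ?thesis
      by (intro exI conjI) (auto simp: prob_space OPT_r)
  next
    case (interior c)
    have "expectation (\<lambda>s. \<sigma> c s * (s - r)) \<le> (1 - C) * expectation (\<lambda>s. s)"
      using interior by (simp add: g_def \<mu>_def)
    then obtain x p where xp: "mechanism vmax F x p" "consistent vmax C p"
      and rev: "(\<integral>(s, v). p s v Hallucinatory \<partial>(F \<Otimes>\<^sub>M F))
        = expectation (\<lambda>s. \<sigma> c s * (r * survival F r) + (1 - \<sigma> c s) * (s * survival F s))"
      using posted_price_mixture[of "\<sigma> c" C r] C \<sigma>_bounds[OF interior(1)] by auto
    have "\<sigma> c s * (r * survival F r) + (1 - \<sigma> c s) * (s * survival F s)
        = OPT F * \<sigma> c s + c * (\<sigma> c s * s) - c * (1 - C) * s" for s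
    proof -
      have "c + survival F s \<noteq> 0"
        using interior(1) survival_nonneg[of s] by linarith
      then have "d c s * survival F s = c * (1 - d c s)"
        by (simp add: d_def field_simps)
      then have "C * (d c s * survival F s) = C * (c * (1 - d c s))"
        by simp
      then have "(1 - \<sigma> c s) * survival F s = c * (\<sigma> c s - (1 - C))"
        by (simp add: \<sigma>_def algebra_simps del: mult_cancel_left)
      then have "(1 - \<sigma> c s) * (s * survival F s) = s * (c * (\<sigma> c s - (1 - C)))"
        by (metis mult.left_commute)
      then show ?thesis
        by (simp add: OPT_r algebra_simps)
    qed
    then have "(\<integral>(s, v). p s v Hallucinatory \<partial>(F \<Otimes>\<^sub>M F))
        = OPT F * expectation (\<sigma> c) + c * expectation (\<lambda>s. \<sigma> c s * s) - c * (1 - C) * \<mu>"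
      unfolding rev using interior(1) weighted_int[OF interior(1)] by (simp add: \<mu>_def)
    \<comment> \<open>Tightness gives E(\<sigma> s) = (1 - C) \<mu> + r E(\<sigma>), which cancels
      the last term.\<close>
    also have "\<dots> = (OPT F + c * r) * expectation (\<sigma> c)"
      unfolding weighted_value[OF interior(1)] interior(2) by (simp add: algebra_simps)
    also have "\<dots> \<ge> (1 + c) * OPT F * expectation (\<sigma> c)"
      using OPT_le_r interior(1) E\<sigma>_nonneg[OF interior(1)]
      by (intro mult_right_mono) (auto simp: algebra_simps)
    finally show ?thesis
      using R_star_OPT[OF interior(1)] xp by (intro exI conjI) auto
  next
    case limit
    define E where "E = expectation (\<lambda>s. (1 - C) * (r * survival F r) + (1 - (1 - C)) * (s * survival F s))"
    have "(1 - C) * (\<mu> - r) \<le> (1 - C) * \<mu>"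
      using r C by (intro mult_left_mono) auto
    then have "expectation (\<lambda>s. (1 - C) * (s - r)) \<le> (1 - C) * expectation (\<lambda>s. s)"
      by (simp add: \<mu>_def prob_space)
    then obtain x p where xp: "mechanism vmax F x p" "consistent vmax C p"
      and rev: "(\<integral>(s, v). p s v Hallucinatory \<partial>(F \<Otimes>\<^sub>M F)) = E"
      using posted_price_mixture[of "\<lambda>_. 1 - C" C r] C unfolding E_def by auto
    \<comment> \<open>The violated constraint bounds r E(\<sigma>) by E((\<sigma> - (1 - C)) s).
      Since c (\<sigma> - (1 - C)) = (1 - \<sigma>) Q <= C Q, multiplying by c leaves at most the
      revenue from posting s with probability C.\<close>
    have bound: "c * OPT F * expectation (\<sigma> c) \<le> E" if c: "0 < c" for c
    proof -
      have "c * OPT F * expectation (\<sigma> c) \<le> c * r * expectation (\<sigma> c)"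
        using OPT_le_r c E\<sigma>_nonneg[OF c] by (intro mult_right_mono mult_left_mono) auto
      also have "\<dots> \<le> c * (g c + r * expectation (\<sigma> c) - (1 - C) * \<mu>)"
        unfolding mult.assoc[of c] using limit[OF c] c by (intro mult_left_mono) auto
      also have "\<dots> = expectation (\<lambda>s. c * (\<sigma> c s * s - (1 - C) * s))"
        using c weighted_int[OF c] by (simp add: weighted_value \<mu>_def)
      also have "\<dots> \<le> E"
        unfolding E_def
      proof (rule integral_mono)
        show "integrable F (\<lambda>s. (1 - C) * (r * survival F r) + (1 - (1 - C)) * (s * survival F s))"
          by simp
        fix s assume "s \<in> space F"
        then have s: "0 \<le> s"
          by (simp add: space_F)
        have "c + survival F s \<noteq> 0"
          using c survival_nonneg[of s] by linarith
        then have "c * (1 - d c s) = d c s * survival F s"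
          by (simp add: d_def field_simps)
        also have "\<dots> \<le> 1 * survival F s"
          using d_bounds[OF c] survival_nonneg by (intro mult_right_mono) auto
        finally have "C * s * (c * (1 - d c s)) \<le> C * s * survival F s"
          using C s by (intro mult_left_mono) auto
        moreover have "0 \<le> (1 - C) * (r * survival F r)"
          using C r survival_nonneg by simp
        ultimately show "c * (\<sigma> c s * s - (1 - C) * s)
            \<le> (1 - C) * (r * survival F r) + (1 - (1 - C)) * (s * survival F s)"
          by (simp add: \<sigma>_def algebra_simps)
      qed (use c weighted_int in auto)
      finally show ?thesis .
    qed
    \<comment> \<open>\<open>bound\<close> controls \<open>c * OPT F\<close> while the target has
      \<open>(1 + c) * OPT F\<close>; their ratio 1 + 1 / c tends to 1 along c = n + 1.\<close>
    have "R_star C * OPT F \<le> (1 + 1 / real (Suc n)) * E" for n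
    proof -
      let ?c = "real (Suc n)"
      have eq: "(1 + 1 / ?c) * ?c = 1 + ?c"
        by (simp add: field_simps)
      have "R_star C * OPT F \<le> (1 + 1 / ?c) * (?c * OPT F * expectation (\<sigma> ?c))"
        unfolding mult.assoc[symmetric] eq using R_star_OPT[of ?c] by simp
      also have "\<dots> \<le> (1 + 1 / ?c) * E"
        using bound[of ?c] by (intro mult_left_mono) auto
      finally show ?thesis .
    qed
    moreover have "(\<lambda>n. (1 + 1 / real (Suc n)) * E) \<longlonglongrightarrow> (1 + 0) * E"
      by (intro tendsto_intros LIMSEQ_Suc lim_1_over_n)
    ultimately have "R_star C * OPT F \<le> E"
      using LIMSEQ_le_const[of "\<lambda>n. (1 + 1 / real (Suc n)) * E" E] by auto
    with xp rev show ?thesis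
      by (intro exI conjI) auto
  qed
qed

end

subsection \<open>Optimality\<close>

context value_distribution
begin

lemma
  assumes mech: "mechanism vmax F x p" and v: "0 \<le> v" "v \<le> vmax"
  shows integrable_allocation: "integrable F (\<lambda>s. x s v Hallucinatory)"
    and integrable_payment: "integrable F (\<lambda>s. p s v Hallucinatory)"
proof -
  have x_bounds: "x s v \<theta> \<in> {0..1}" if "0 \<le> s" "s \<le> vmax" for s \<theta>
    using mech v that by (simp add: mechanism_def)
  have "(\<lambda>(s, v). x s v Hallucinatory) \<in> borel_measurable (F \<Otimes>\<^sub>M F)"
    using mech by (simp add: mechanism_def)
  from measurable_Pair1'[of v F F] measurable_compose[OF _ this, of "\<lambda>s. (s, v)" F] v
  have "(\<lambda>s. x s v Hallucinatory) \<in> borel_measurable F"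
    by (simp add: space_F)
  then show "integrable F (\<lambda>s. x s v Hallucinatory)"
    using x_bounds by (intro integrable_bounded[where B = 1]) force+
  show "integrable F (\<lambda>s. p s v Hallucinatory)"
    using mech v by (simp add: mechanism_def)
qed

definition utility :: "(real \<Rightarrow> real \<Rightarrow> state \<Rightarrow> real) \<Rightarrow> (real \<Rightarrow> real \<Rightarrow> state \<Rightarrow> real) \<Rightarrow> real \<Rightarrow> real" where
  "utility x p v = (\<integral>s. v * x s v Hallucinatory - p s v Hallucinatory \<partial>F)"

lemma utility_nonneg:
  "mechanism vmax F x p \<Longrightarrow> 0 \<le> v \<Longrightarrow> v \<le> vmax \<Longrightarrow> 0 \<le> utility x p v"
  by (simp add: mechanism_def utility_def)

text \<open>
  By the envelope theorem the derivative of \<open>u v / v\<close> is the payment of type \<open>v\<close> divided by \<open>v\<^sup>2\<close>.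
\<close>

lemma payment_le_utility_difference:
  assumes mech: "mechanism vmax F x p" and "0 < a" "a \<le> b" "b \<le> vmax"
  shows "(1 / a - 1 / b) * (\<integral>s. p s a Hallucinatory \<partial>F) \<le> utility x p b / b - utility x p a / a"
proof -
  define X where "X = (\<integral>s. x s a Hallucinatory \<partial>F)"
  define P where "P = (\<integral>s. p s a Hallucinatory \<partial>F)"
  have [simp]: "integrable F (\<lambda>s. x s a Hallucinatory)" "integrable F (\<lambda>s. p s a Hallucinatory)"
    using integrable_allocation[OF mech, of a] integrable_payment[OF mech, of a] assms by auto
  have u_a: "utility x p a = a * X - P"
    by (simp add: utility_def X_def P_def)
  have "(\<integral>s. b * x s a Hallucinatory - p s a Hallucinatory \<partial>F) \<le> utility x p b"
  proof -
    have "a \<in> {0..vmax}" "b \<in> {0..vmax}"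
      using assms by auto
    then show ?thesis
      using mech unfolding mechanism_def utility_def by blast
  qed
  then have "b * X - P \<le> utility x p b"
    by (simp add: X_def P_def)
  then have "(b * X - P) / b \<le> utility x p b / b"
    using assms by (intro divide_right_mono) auto
  moreover have "(b * X - P) / b - (a * X - P) / a = (1 / a - 1 / b) * P"
    using assms by (simp add: field_simps)
  ultimately show ?thesis
    by (simp add: u_a P_def)
qed

text \<open>In state A type s could report vmax in state H, but by consistency its truthful utility
  is at most s - C s. Raising the value from s to vmax adds at most vmax - s to the utility of that
  report. Averaging over s gives the bound.\<close>

lemma top_utility_le:
  assumes mech: "mechanism vmax F x p" and cons: "consistent vmax C p"
  shows "utility x p vmax \<le> vmax - C * expectation (\<lambda>s. s)"
proof -
  have "utility x p vmax \<le> expectation (\<lambda>s. vmax - C * s)"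
    unfolding utility_def
  proof (rule integral_mono)
    show "integrable F (\<lambda>s. vmax * x s vmax Hallucinatory - p s vmax Hallucinatory)"
      using integrable_allocation[OF mech vmax_nonneg] integrable_payment[OF mech vmax_nonneg] by simp
    fix s assume "s \<in> space F"
    then have s: "0 \<le> s" "s \<le> vmax"
      by (auto simp: space_F)
    have "x s vmax Hallucinatory \<in> {0..1}" "x s s Accurate \<in> {0..1}"
      "s * x s vmax Hallucinatory - p s vmax Hallucinatory \<le> s * x s s Accurate - p s s Accurate"
      using mech s vmax_nonneg by (simp_all add: mechanism_def)
    moreover have "C * s \<le> p s s Accurate"
      using cons s by (simp add: consistent_def)
    moreover have "(vmax - s) * x s vmax Hallucinatory \<le> vmax - s" "s * x s s Accurate \<le> s"
      using calculation s by (auto intro!: mult_left_le)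
    ultimately show "vmax * x s vmax Hallucinatory - p s vmax Hallucinatory \<le> vmax - C * s"
      by (simp add: algebra_simps)
  qed simp
  also have "\<dots> = vmax - C * expectation (\<lambda>s. s)"
    by (simp add: prob_space)
  finally show ?thesis .
qed

lemma revenue_eq_iterated:
  assumes "mechanism vmax F x p"
  shows "(\<lambda>v. \<integral>s. p s v Hallucinatory \<partial>F) \<in> borel_measurable F"
    and "(\<integral>(s, v). p s v Hallucinatory \<partial>(F \<Otimes>\<^sub>M F)) = (\<integral>v. (\<integral>s. p s v Hallucinatory \<partial>F) \<partial>F)"
proof -
  interpret P: pair_prob_space F F ..
  have int: "integrable (F \<Otimes>\<^sub>M F) (\<lambda>(s, v). p s v Hallucinatory)"
    using assms by (simp add: mechanism_def)
  show "(\<lambda>v. \<integral>s. p s v Hallucinatory \<partial>F) \<in> borel_measurable F"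
    using P.integrable_snd[OF int] by (rule borel_measurable_integrable)
  show "(\<integral>(s, v). p s v Hallucinatory \<partial>(F \<Otimes>\<^sub>M F)) = (\<integral>v. (\<integral>s. p s v Hallucinatory \<partial>F) \<partial>F)"
    using P.integral_snd[OF int] by simp
qed

end

text \<open>
  A discretisation of the distribution on \<open>[vmax / h, vmax]\<close> with \<open>h = 1 + 1 / \<beta>\<close> whose density is
  proportional to \<open>1 / v\<^sup>2\<close>, equivalently whose revenue curve is a straight line of slope \<open>- \<beta>\<close>.
  Rounding down to a geometric grid makes the bounds on the utility differences telescope exactly.
\<close>

lemma hard_distribution:
  fixes \<beta> vmax :: real and n :: nat
  assumes pos: "0 < vmax" "0 < \<beta>" "0 < n"
  defines "h \<equiv> 1 + 1 / \<beta>"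
  shows "\<exists>F. distribution_on vmax F \<and> vmax / h \<le> OPT F \<and>
    (\<forall>C x p. mechanism vmax F x p \<and> consistent vmax C p \<longrightarrow>
      (\<integral>(s, v). p s v Hallucinatory \<partial>(F \<Otimes>\<^sub>M F))
        \<le> vmax / h * ((1 + \<beta>) - C * (\<beta> + \<beta>\<^sup>2) * (real n * (1 - exp (- ln h / real n)))))"
proof -
  have h: "1 < h" "\<beta> * h = 1 + \<beta>"
    using assms by (auto simp: field_simps)
  define \<rho> where "\<rho> = exp (ln h / real n)"
  have \<rho>: "1 < \<rho>" "\<rho> ^ n = h"
    using h(1) \<open>0 < n\<close> by (auto simp: \<rho>_def exp_of_nat_mult[symmetric])
  define a where "a i = vmax / h * \<rho> ^ i" for i
  \<comment> \<open>The mass that the survival function Q(v) = (1 + \<beta>) (vmax / h) / v -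
    \<beta> gives to [a i, a (i + 1)). Thus \<open>a n\<close> = vmax carries no mass, but as a type
    it ends the telescoping sum.\<close>
  define m where "m i = (1 + \<beta>) * (1 / \<rho> ^ i - 1 / \<rho> ^ Suc i)" for i
  define M where "M = point_measure {..<n} (\<lambda>i. ennreal (m i))"
  define F where "F = distr M (restrict_space borel {0..vmax}) a"
  have a_pos: "0 < a i" for i
    using pos h \<rho> by (simp add: a_def)
  have a_mono: "a i \<le> a j" if "i \<le> j" for i j
    unfolding a_def using that pos h \<rho> by (intro mult_left_mono power_increasing) auto
  have a_n: "a n = vmax"
    using h \<rho> by (simp add: a_def)
  have a_le: "a i \<le> vmax" if "i \<le> n" for i
    using a_mono[OF that] by (simp add: a_n)
  have m_nonneg: "0 \<le> m i" for i
  proof -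
    have "1 / \<rho> ^ Suc i \<le> 1 / \<rho> ^ i"
      using \<rho> by (intro divide_left_mono power_increasing) auto
    then show ?thesis
      using pos by (simp add: m_def)
  qed
  have "(\<Sum>i<n. m i) = (1 + \<beta>) * (1 - 1 / h)"
    unfolding m_def sum_distrib_left[symmetric]
    using sum_lessThan_telescope'[of "\<lambda>i. 1 / \<rho> ^ i" n] \<rho> by simp
  also have "\<dots> = 1"
    using h pos by (simp add: field_simps)
  finally have m_sum: "(\<Sum>i<n. m i) = 1" .
  interpret M: prob_space M
    unfolding M_def using m_nonneg m_sum
    by (intro prob_space_point_measure) (auto simp: sum_ennreal)
  have space_M: "space M = {..<n}"
    by (simp add: M_def space_point_measure)
  have a_meas: "a \<in> measurable M (restrict_space borel {0..vmax})"
    unfolding M_def using a_pos a_le by (auto simp: space_restrict_space less_imp_le)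
  interpret F: value_distribution F vmax
    using M.prob_space_distr[OF a_meas]
    by (intro value_distribution.intro value_distribution_axioms.intro) (simp_all add: F_def)
  have expectation_F: "F.expectation f = (\<Sum>i<n. m i * f (a i))" if "f \<in> borel_measurable F" for f :: "real \<Rightarrow> real"
  proof -
    have "f \<in> borel_measurable (restrict_space borel {0..vmax})"
      using that by (simp add: F_def)
    then have "F.expectation f = (\<integral>i. f (a i) \<partial>M)"
      unfolding F_def by (rule integral_distr[OF a_meas])
    also have "\<dots> = (\<Sum>i<n. m i * f (a i))"
      unfolding M_def using m_nonneg by (subst lebesgue_integral_point_measure_finite) auto
    finally show ?thesis .
  qed
  have mean: "F.expectation (\<lambda>s. s) = vmax / h * (1 + \<beta>) * (real n * (1 - exp (- ln h / real n)))"
  proof -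
    \<comment> \<open>On a geometric grid every atom contributes the same amount to the
      mean.\<close>
    have "m i * a i = vmax / h * (1 + \<beta>) * (1 - exp (- ln h / real n))" for i
    proof -
      have "m i * a i = vmax / h * (1 + \<beta>) * (1 - 1 / \<rho>)"
        unfolding m_def a_def using \<rho> h by (simp add: field_simps)
      also have "1 / \<rho> = exp (- ln h / real n)"
        by (simp add: \<rho>_def exp_minus inverse_eq_divide)
      finally show ?thesis .
    qed
    then show ?thesis
      by (subst expectation_F) auto
  qed
  \<comment> \<open>The lowest grid price \<open>a 0\<close> = vmax / h always sells.\<close>
  have "survival F (vmax / h) = 1"
  proof -
    have "F.prob {w \<in> space F. vmax / h \<le> w} = M.prob (a -` {w \<in> space F. vmax / h \<le> w} \<inter> space M)"
      unfolding F_def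
      by (rule measure_distr[OF a_meas], subst F.sets_F[symmetric], unfold F_def[symmetric]) measurable
    also have "a -` {w \<in> space F. vmax / h \<le> w} \<inter> space M = space M"
      using a_mono[of 0] a_pos a_le by (auto simp: F.space_F space_M a_def[of 0] less_imp_le)
    finally show ?thesis
      by (simp add: F.survival_eq M.prob_space)
  qed
  then have OPT: "vmax / h \<le> OPT F"
    using F.revenue_le_OPT[of "vmax / h"] pos h by simp

  have "(\<integral>(s, v). p s v Hallucinatory \<partial>(F \<Otimes>\<^sub>M F))
      \<le> vmax / h * ((1 + \<beta>) - C * (\<beta> + \<beta>\<^sup>2) * (real n * (1 - exp (- ln h / real n))))"
    if mech: "mechanism vmax F x p" and cons: "consistent vmax C p" for C x p
  proof -
    let ?u = "F.utility x p"
    define P where "P v = (\<integral>s. p s v Hallucinatory \<partial>F)" for v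
    have step: "m i * P (a i) \<le> (1 + \<beta>) * (vmax / h) * (?u (a (Suc i)) / a (Suc i) - ?u (a i) / a i)"
      if "i < n" for i
    proof -
      have "m i = (1 + \<beta>) * (vmax / h) * (1 / a i - 1 / a (Suc i))"
        unfolding m_def a_def using pos h \<rho> by (simp add: field_simps)
      moreover have "(1 / a i - 1 / a (Suc i)) * P (a i) \<le> ?u (a (Suc i)) / a (Suc i) - ?u (a i) / a i"
        unfolding P_def
        using that by (intro F.payment_le_utility_difference[OF mech] a_pos a_mono a_le) auto
      then have "(1 + \<beta>) * (vmax / h) * ((1 / a i - 1 / a (Suc i)) * P (a i))
          \<le> (1 + \<beta>) * (vmax / h) * (?u (a (Suc i)) / a (Suc i) - ?u (a i) / a i)"
        using pos h by (intro mult_left_mono) auto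
      ultimately show ?thesis
        by (simp only: mult.assoc)
    qed
    have "(\<integral>(s, v). p s v Hallucinatory \<partial>(F \<Otimes>\<^sub>M F)) = F.expectation P"
      unfolding P_def by (rule F.revenue_eq_iterated[OF mech])
    also have "\<dots> = (\<Sum>i<n. m i * P (a i))"
      using F.revenue_eq_iterated(1)[OF mech] unfolding P_def[symmetric] by (rule expectation_F)
    also have "\<dots> \<le> (\<Sum>i<n. (1 + \<beta>) * (vmax / h) * (?u (a (Suc i)) / a (Suc i) - ?u (a i) / a i))"
      by (intro sum_mono step) simp
    also have "\<dots> = (1 + \<beta>) * (vmax / h) * (?u vmax / vmax - ?u (a 0) / a 0)"
      unfolding sum_distrib_left[symmetric] using sum_lessThan_telescope[of "\<lambda>i. ?u (a i) / a i" n]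
      by (simp add: a_n)
    also have "\<dots> \<le> (1 + \<beta>) * (vmax / h) * (?u vmax / vmax)"
      using pos h F.utility_nonneg[OF mech, of "a 0"] a_pos[of 0] a_le[of 0]
      by (intro mult_left_mono) auto
    \<comment> \<open>By the choice of h, (1 + \<beta>) / h = \<beta>.\<close>
    also have "\<dots> = \<beta> * ?u vmax"
      using pos h by (simp add: h(2)[symmetric])
    also have "\<dots> \<le> \<beta> * (vmax - C * F.expectation (\<lambda>s. s))"
      using F.top_utility_le[OF mech cons] pos by (intro mult_left_mono) auto
    also have "\<dots> = vmax / h * ((\<beta> * h) - C * (\<beta> + \<beta>\<^sup>2) * (real n * (1 - exp (- ln h / real n))))"
      unfolding mean using h(1) by (simp add: field_simps power2_eq_square)
    finally show ?thesis
      by (simp add: h)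
  qed
  moreover have "distribution_on vmax F"
    unfolding distribution_on_iff_value_distribution by unfold_locales
  ultimately show ?thesis
    using OPT by blast
qed

theorem theorem1p1:
  fixes vmax C :: real
  assumes "0 < vmax" and "0 \<le> C" and "C \<le> 1"
  shows "(\<forall>F R. distribution_on vmax F \<and> R \<le> R_star C \<longrightarrow>
            (\<exists>x p. mechanism vmax F x p \<and> consistent vmax C p \<and> robust F R p)) \<and>
         (\<forall>R. R > R_star C \<longrightarrow>
            (\<exists>F. distribution_on vmax F \<and>
              \<not> (\<exists>x p. mechanism vmax F x p \<and> consistent vmax C p \<and> robust F R p)))"
proof (intro conjI allI impI)
  fix F R
  assume "distribution_on vmax F \<and> R \<le> R_star C"
  then interpret value_distribution F vmax
    by (simp add: distribution_on_iff_value_distribution)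
  have "R * OPT F \<le> R_star C * OPT F"
    using \<open>distribution_on vmax F \<and> R \<le> R_star C\<close> OPT_nonneg by (intro mult_right_mono) auto
  then show "\<exists>x p. mechanism vmax F x p \<and> consistent vmax C p \<and> robust F R p"
    using optimal_mechanism_exists[OF assms(2,3)] unfolding robust_def by (meson order_trans)
next
  fix R
  assume R: "R_star C < R"
  then obtain \<beta> where \<beta>: "0 < \<beta>" and less: "(1 + \<beta>) - C * (\<beta> + \<beta>\<^sup>2) * ln (1 + 1 / \<beta>) < R"
    unfolding R_star_def
    by (subst (asm) cINF_less_iff[OF _ bdd_below_robustness_bound[OF assms(2,3)]]) auto
  define h where "h = 1 + 1 / \<beta>"
  have h: "1 < h"
    using \<beta> by (simp add: h_def)
  \<comment> \<open>With L = ln h, the mean of the discretised distribution tends to that of the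
    continuous one.\<close>
  have "((\<lambda>n. real n * (1 - exp (- L / real n))) \<longlongrightarrow> L) at_top" if "0 < L" for L :: real
    using that by real_asymp
  from this[of "ln h"] h
  have "(\<lambda>n. (1 + \<beta>) - C * (\<beta> + \<beta>\<^sup>2) * (real n * (1 - exp (- ln h / real n))))
      \<longlonglongrightarrow> (1 + \<beta>) - C * (\<beta> + \<beta>\<^sup>2) * ln h"
    by (intro tendsto_intros) simp
  from order_tendstoD(2)[OF this, of R] less
  have "\<forall>\<^sub>F n in sequentially. (1 + \<beta>) - C * (\<beta> + \<beta>\<^sup>2) * (real n * (1 - exp (- ln h / real n))) < R"
    by (simp add: h_def)
  with eventually_gt_at_top[of 0] have "\<forall>\<^sub>F n in sequentially. 0 < n \<and>
      (1 + \<beta>) - C * (\<beta> + \<beta>\<^sup>2) * (real n * (1 - exp (- ln h / real n))) < R"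
    by eventually_elim simp
  then obtain n where n: "0 < n"
      "(1 + \<beta>) - C * (\<beta> + \<beta>\<^sup>2) * (real n * (1 - exp (- ln h / real n))) < R"
    using eventually_happens'[OF sequentially_bot] by blast
  obtain F where F: "distribution_on vmax F" and OPT: "vmax / h \<le> OPT F"
    and bound: "\<And>x p. mechanism vmax F x p \<Longrightarrow> consistent vmax C p \<Longrightarrow>
      (\<integral>(s, v). p s v Hallucinatory \<partial>(F \<Otimes>\<^sub>M F))
        \<le> vmax / h * ((1 + \<beta>) - C * (\<beta> + \<beta>\<^sup>2) * (real n * (1 - exp (- ln h / real n))))"
    using hard_distribution[OF assms(1) \<beta> n(1)] unfolding h_def by blast
  have "\<not> robust F R p" if "mechanism vmax F x p" "consistent vmax C p" for x p
  proof -
    note bound[OF that]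
    also have "vmax / h * ((1 + \<beta>) - C * (\<beta> + \<beta>\<^sup>2) * (real n * (1 - exp (- ln h / real n))))
        < vmax / h * R"
      using n(2) assms(1) h by (intro mult_strict_left_mono) auto
    \<comment> \<open>Here R > \<open>R_star C\<close> >= 0 allows the lower bound on
      \<open>OPT F\<close> to be multiplied by R.\<close>
    also have "\<dots> \<le> R * OPT F"
      using mult_left_mono[OF OPT, of R] R R_star_nonneg[OF assms(2,3)] by (simp add: mult.commute)
    finally show ?thesis
      by (simp add: robust_def)
  qed
  with F show "\<exists>F. distribution_on vmax F \<and>
      \<not> (\<exists>x p. mechanism vmax F x p \<and> consistent vmax C p \<and> robust F R p)"
    by blast
qed

end
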